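(* Let $\tau = \frac{4-\sqrt{7}}{9}$. For every $\epsilon > 0$ there exist a positive integer $n$ and simple graphs $G_1, G_2, G_3$ on a common set of $n$ vertices that have no rainbow triangle and satisfy $|E(G_i)| > \left(\frac{1+\tau^2}{4} - \epsilon\right) n^2$ for every $1 \le i \le 3$.
   Context: All graphs are finite and simple. For three graphs $G_1, G_2, G_3$ on a common vertex set $V$, a rainbow triangle consists of three distinct vertices $v_1, v_2, v_3 \in V$ such that $v_1v_2 \in E(G_1)$, $v_2v_3 \in E(G_2)$ and $v_3v_1 \in E(G_3)$. *)

theory Defs
  imports Complex_Main "HOL-Library.Ramsey"
begin

(* A finite simple graph, given by its vertex set and its set of edges, each edge being
   a two-element set of vertices. *)
definition simple_graph :: "'a set \<Rightarrow> 'a set set \<Rightarrow> bool" where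
  "simple_graph V E \<longleftrightarrow> finite V \<and> E \<subseteq> [V]\<^bsup>2\<^esup>"

definition rainbow_triangle ::
    "'a set \<Rightarrow> 'a set set \<Rightarrow> 'a set set \<Rightarrow> 'a set set \<Rightarrow> 'a \<Rightarrow> 'a \<Rightarrow> 'a \<Rightarrow> bool" where
  "rainbow_triangle V E1 E2 E3 v1 v2 v3 \<longleftrightarrow>
     v1 \<in> V \<and> v2 \<in> V \<and> v3 \<in> V \<and> v1 \<noteq> v2 \<and> v2 \<noteq> v3 \<and> v3 \<noteq> v1 \<and>
     {v1, v2} \<in> E1 \<and> {v2, v3} \<in> E2 \<and> {v3, v1} \<in> E3"

definition tau :: real where
  "tau = (4 - sqrt 7) / 9"

end

(*
  Split the n vertices into A, B of size about tau * n and C of size about (1 - 2 tau) n, and put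
    G1 = all pairs inside B or inside C,
    G2 = all pairs inside A or inside C,
    G3 = all pairs not inside C.
  If v1 v2 lies in G1 and v2 v3 in G2, then v2 lies in C, hence so do v1 and v3, and v3 v1 is not
  in G3.  The number tau is the root of 9 x^2 - 8 x + 1 for which the three edge densities agree,
  and their common value is (1 + tau^2) / 4.
*)
theory Submission
  imports Defs
begin

lemma tau_bounds: "0 < tau" "tau < 1 / 2"
proof -
  define s :: real where "s = sqrt 7"
  have "s < 4" unfolding s_def by (rule real_less_lsqrt) auto
  moreover have "0 \<le> s" by (simp add: s_def)
  moreover have "tau = (4 - s) / 9" by (simp add: tau_def s_def)
  ultimately show "0 < tau" "tau < 1 / 2" by auto
qed

text \<open>This equation turns both leading coefficients below,
  \<open>5 * tau\<^sup>2 - 4 * tau + 1\<close> and \<open>4 * (tau - tau\<^sup>2)\<close>, into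
  \<open>(1 + tau\<^sup>2) / 2\<close>.\<close>

lemma tau_quadratic: "9 * tau\<^sup>2 - 8 * tau + 1 = 0"
  by (simp add: tau_def power2_eq_square field_simps)

lemma real_card_nsets_2:
  "real (card ([X]\<^bsup>2\<^esup>)) = real (card X) * (real (card X) - 1) / 2"
proof -
  have "card ([X]\<^bsup>2\<^esup>) = card X * (card X - 1) div 2"
    by (simp add: card_nsets choose_two)
  moreover have "2 dvd card X * (card X - 1)" by (cases "card X") auto
  ultimately have "real (card ([X]\<^bsup>2\<^esup>)) = real (card X * (card X - 1)) / 2"
    by (simp add: real_of_nat_div)
  then show ?thesis by (cases "card X") (auto simp: algebra_simps)
qed

lemma real_card_nsets_2_Un:
  assumes "finite X" "finite Y" "X \<inter> Y = {}"
  shows "real (card ([X]\<^bsup>2\<^esup> \<union> [Y]\<^bsup>2\<^esup>)) =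
    (real (card X) * (real (card X) - 1) + real (card Y) * (real (card Y) - 1)) / 2"
proof -
  have "[X]\<^bsup>2\<^esup> \<inter> [Y]\<^bsup>2\<^esup> = {}"
  proof (rule equals0I)
    fix e assume "e \<in> [X]\<^bsup>2\<^esup> \<inter> [Y]\<^bsup>2\<^esup>"
    then have "e \<subseteq> X \<inter> Y" "card e = 2" by (auto simp: nsets_def)
    then show False using assms(3) by simp
  qed
  then have "card ([X]\<^bsup>2\<^esup> \<union> [Y]\<^bsup>2\<^esup>) = card ([X]\<^bsup>2\<^esup>) + card ([Y]\<^bsup>2\<^esup>)"
    using assms by (intro card_Un_disjoint) (auto simp: finite_imp_finite_nsets)
  then show ?thesis by (simp add: real_card_nsets_2 add_divide_distrib del: card_nsets)
qed

lemma real_card_nsets_2_Diff: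
  assumes "finite V" "C \<subseteq> V"
  shows "real (card ([V]\<^bsup>2\<^esup> - [C]\<^bsup>2\<^esup>)) =
    (real (card V) * (real (card V) - 1) - real (card C) * (real (card C) - 1)) / 2"
proof -
  have sub: "[C]\<^bsup>2\<^esup> \<subseteq> [V]\<^bsup>2\<^esup>" by (rule nsets_mono[OF assms(2)])
  have fin: "finite ([V]\<^bsup>2\<^esup>)" using assms(1) by (rule finite_imp_finite_nsets)
  have "card ([V]\<^bsup>2\<^esup> - [C]\<^bsup>2\<^esup>) = card ([V]\<^bsup>2\<^esup>) - card ([C]\<^bsup>2\<^esup>)"
    using sub fin by (simp add: card_Diff_subset finite_subset)
  moreover have "card ([C]\<^bsup>2\<^esup>) \<le> card ([V]\<^bsup>2\<^esup>)" using fin sub by (rule card_mono)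
  ultimately show ?thesis
    by (simp add: real_card_nsets_2 of_nat_diff diff_divide_distrib del: card_nsets)
qed

lemma no_rainbow_triangle:
  assumes "A \<inter> B = {}" "A \<inter> C = {}" "B \<inter> C = {}"
  shows "\<not> rainbow_triangle V ([B]\<^bsup>2\<^esup> \<union> [C]\<^bsup>2\<^esup>) ([A]\<^bsup>2\<^esup> \<union> [C]\<^bsup>2\<^esup>) ([V]\<^bsup>2\<^esup> - [C]\<^bsup>2\<^esup>) v1 v2 v3"
  using assms unfolding rainbow_triangle_def by (auto simp: nsets_def)

text \<open>Serves \<open>G 1\<close> and \<open>G 2\<close>: \<open>m\<close> is the common size of
  \<open>A\<close> and \<open>B\<close>, \<open>n - 2 * m\<close> that of \<open>C\<close>, and
  \<open>d\<close> the error of rounding \<open>tau * n\<close> down. Rounding costs only terms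
  linear in \<open>n\<close>.\<close>

lemma two_cliques_count:
  fixes n m d :: real
  assumes n: "n \<ge> 1" and d: "0 \<le> d" "d < 1" and m: "m = tau * n - d"
  shows "(m * (m - 1) + (n - 2 * m) * (n - 2 * m - 1)) / 2 \<ge> (1 + tau\<^sup>2) / 4 * n\<^sup>2 - 2 * n"
proof -
  have "m * (m - 1) + (n - 2 * m) * (n - 2 * m - 1)
        = (5 * tau\<^sup>2 - 4 * tau + 1) * n\<^sup>2 + 2 * (d * (2 - 5 * tau) * n) + 5 * d\<^sup>2 + tau * n - d - n"
    unfolding m by (simp add: power2_eq_square algebra_simps)
  also have "5 * tau\<^sup>2 - 4 * tau + 1 = (1 + tau\<^sup>2) / 2" using tau_quadratic by simp
  finally have eq: "m * (m - 1) + (n - 2 * m) * (n - 2 * m - 1)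
        = (1 + tau\<^sup>2) / 2 * n\<^sup>2 + 2 * (d * (2 - 5 * tau) * n) + 5 * d\<^sup>2 + tau * n - d - n" .
  \<comment> \<open>The crude bound \<open>tau < 1 / 2\<close> already gives
    \<open>2 - 5 * tau > - 1 / 2\<close>.\<close>
  have "d * (- 1 / 2) \<le> d * (2 - 5 * tau)"
    using tau_bounds d by (intro mult_left_mono) auto
  then have "- 1 / 2 \<le> d * (2 - 5 * tau)" using d by simp
  then have "- 1 / 2 * n \<le> d * (2 - 5 * tau) * n" using n by (intro mult_right_mono) auto
  moreover have "0 \<le> tau * n" using tau_bounds n by simp
  \<comment> \<open>The cross term, \<open>- d\<close> and \<open>- n\<close> each cost at most
    \<open>n\<close>, so \<open>4 * n\<close> leaves slack.\<close>
  ultimately have "(1 + tau\<^sup>2) / 2 * n\<^sup>2 - 4 * n \<le> m * (m - 1) + (n - 2 * m) * (n - 2 * m - 1)"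
    using eq n d zero_le_power2[of d] by linarith
  then show ?thesis by (simp add: field_simps)
qed

text \<open>The counterpart for \<open>G 3\<close>, the pairs not inside \<open>C\<close>, with the
  same \<open>m\<close> and \<open>d\<close>.\<close>

lemma clique_complement_count:
  fixes n m d :: real
  assumes n: "n \<ge> 1" and d: "0 \<le> d" "d < 1" and m: "m = tau * n - d"
  shows "(n * (n - 1) - (n - 2 * m) * (n - 2 * m - 1)) / 2 \<ge> (1 + tau\<^sup>2) / 4 * n\<^sup>2 - 5 * n"
proof -
  have "n * (n - 1) - (n - 2 * m) * (n - 2 * m - 1)
        = 4 * (tau - tau\<^sup>2) * n\<^sup>2 - 4 * (d * (1 - 2 * tau) * n) - 4 * d\<^sup>2 - 2 * (tau * n) + 2 * d"
    unfolding m by (simp add: power2_eq_square algebra_simps)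
  also have "4 * (tau - tau\<^sup>2) = (1 + tau\<^sup>2) / 2" using tau_quadratic by simp
  finally have eq: "n * (n - 1) - (n - 2 * m) * (n - 2 * m - 1)
        = (1 + tau\<^sup>2) / 2 * n\<^sup>2 - 4 * (d * (1 - 2 * tau) * n) - 4 * d\<^sup>2 - 2 * (tau * n) + 2 * d" .
  have "d * (1 - 2 * tau) \<le> 1 * 1"
    using tau_bounds d by (intro mult_mono) auto
  then have "d * (1 - 2 * tau) * n \<le> 1 * n" using n by (intro mult_right_mono) auto
  moreover have "tau * n \<le> 1 / 2 * n" using tau_bounds n by (intro mult_right_mono) auto
  moreover have "d\<^sup>2 \<le> 1" using d by (simp add: power_le_one)
  \<comment> \<open>The losses are at most \<open>4 * n\<close> from the cross term,
    \<open>4 \<le> 4 * n\<close> from the square of \<open>d\<close>, and \<open>n\<close> from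
    \<open>2 * (tau * n)\<close>.\<close>
  ultimately have "(1 + tau\<^sup>2) / 2 * n\<^sup>2 - 10 * n \<le> n * (n - 1) - (n - 2 * m) * (n - 2 * m - 1)"
    using eq n d by linarith
  then show ?thesis by (simp add: field_simps)
qed

theorem mainTheorem2:
  fixes \<epsilon> :: real
  assumes "\<epsilon> > 0"
  shows "\<exists>(n::nat) (V::nat set) (G :: nat \<Rightarrow> nat set set).
           n > 0 \<and> card V = n \<and>
           (\<forall>i\<in>{1..3}. simple_graph V (G i)) \<and>
           (\<nexists>v1 v2 v3. rainbow_triangle V (G 1) (G 2) (G 3) v1 v2 v3) \<and>
           (\<forall>i\<in>{1..3}. real (card (G i)) > ((1 + tau\<^sup>2) / 4 - \<epsilon>) * (real n)\<^sup>2)"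
proof -
  \<comment> \<open>The 5 is the larger of the two linear error constants; \<open>n\<close> is taken
    so large that \<open>\<epsilon> * (real n)\<^sup>2\<close> exceeds this error.\<close>
  obtain N :: nat where N: "5 / \<epsilon> < real N" using reals_Archimedean2 by blast
  define n where "n = Suc N"
  have n1: "real n \<ge> 1" and "5 / \<epsilon> < real n" using N by (auto simp: n_def)
  then have "5 < \<epsilon> * real n" using assms by (simp add: field_simps)
  then have "5 * real n < \<epsilon> * real n * real n"
    using n1 by (intro mult_strict_right_mono) auto
  then have eps: "5 * real n < \<epsilon> * (real n)\<^sup>2" by (simp add: power2_eq_square mult.assoc)

  define m where "m = nat \<lfloor>tau * real n\<rfloor>"
  define d where "d = tau * real n - real m"
  have "0 \<le> tau * real n" using tau_bounds by simp
  then have "real m = of_int \<lfloor>tau * real n\<rfloor>" by (simp add: m_def)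
  then have d: "0 \<le> d" "d < 1" unfolding d_def by linarith+
  have m: "real m = tau * real n - d" by (simp add: d_def)
  \<comment> \<open>This yields \<open>2 * m \<le> n\<close>, so \<open>A\<close>, \<open>B\<close>
    and \<open>C\<close> fit into \<open>V\<close> and the natural subtraction
    \<open>n - 2 * m\<close> does not truncate.\<close>
  have "tau * real n \<le> 1 / 2 * real n" using tau_bounds n1 by (intro mult_right_mono) auto
  then have "2 * real m \<le> real n" using m d by simp
  then have mn: "2 * m \<le> n" by linarith

  define A where "A = {..<m}"
  define B where "B = {m..<2 * m}"
  define C where "C = {2 * m..<n}"
  define V where "V = {..<n}"
  note ABCV = A_def B_def C_def V_def
  have card: "card V = n" "card A = m" "card B = m" "card C = n - 2 * m"
    by (auto simp: ABCV)
  have realC: "real (card C) = real n - 2 * real m" using card mn by (simp add: of_nat_diff)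
  have fin: "finite A" "finite B" "finite C" "finite V" by (auto simp: ABCV)
  have disj: "A \<inter> B = {}" "A \<inter> C = {}" "B \<inter> C = {}" by (auto simp: ABCV)
  have sub: "A \<subseteq> V" "B \<subseteq> V" "C \<subseteq> V" using mn by (auto simp: ABCV)

  \<comment> \<open>Every index other than 1 and 2 gets the third graph, so the edge bound below can
    be proved for all \<open>i\<close>.\<close>
  define G where "G i =
    (if i = 1 then [B]\<^bsup>2\<^esup> \<union> [C]\<^bsup>2\<^esup> else if i = 2 then [A]\<^bsup>2\<^esup> \<union> [C]\<^bsup>2\<^esup> else [V]\<^bsup>2\<^esup> - [C]\<^bsup>2\<^esup>)"
    for i :: nat
  have "\<forall>i\<in>{1..3}. simple_graph V (G i)"
    using sub[THEN nsets_mono] fin by (auto simp: simple_graph_def G_def)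
  moreover have "\<nexists>v1 v2 v3. rainbow_triangle V (G 1) (G 2) (G 3) v1 v2 v3"
    using no_rainbow_triangle[OF disj] by (simp add: G_def)
  moreover have "((1 + tau\<^sup>2) / 4 - \<epsilon>) * (real n)\<^sup>2 < real (card (G i))" for i
  proof -
    \<comment> \<open>The weaker error term \<open>5 * real n\<close> covers all three graphs at
      once.\<close>
    have "(1 + tau\<^sup>2) / 4 * (real n)\<^sup>2 - 5 * real n \<le> real (card (G i))"
      using two_cliques_count[OF n1 d m] clique_complement_count[OF n1 d m] n1
      by (simp add: G_def real_card_nsets_2_Un real_card_nsets_2_Diff fin disj sub realC card(1-3))
    then show ?thesis using eps by (simp add: left_diff_distrib)
  qed
  moreover have "n > 0" by (simp add: n_def)
  ultimately show ?thesis using card(1) by blast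
qed

end
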